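(* Let $w\in\mathfrak{S}_n$ be a permutation. The Stanley symmetric function $F_w$ attains the lower bound (equivalently, its monomial coefficients are all $0$ or $1$) if and only if $w$ avoids the patterns $321$, $2143$, $2413$, $3142$ and $3412$.
   Context: Notation: $[n]=\{1,\ldots,n\}$; $w=w_1\cdots w_n$ in one-line notation. $w$ contains a pattern $v=v_1\cdots v_m\in\mathfrak{S}_m$ if there are indices $i_1<\cdots<i_m$ such that $w_{i_1},\ldots,w_{i_m}$ are in the same relative order as $v_1,\ldots,v_m$; otherwise $w$ avoids $v$. The Rothe diagram of $w$ is $$D(w)=\{(i,j)\in[n]^2:\ j<w_i,\ i<w^{-1}(j)\}.$$ A diagram $D\subseteq[n]^2$ is identified with the list $D=(D_1,\ldots,D_n)$, $D_j=\{i:(i,j)\in D\}$. For a diagram $C=(C_1,\ldots,C_n)$ put $\mathbf{x}^C=\prod_{j=1}^n\prod_{i\in C_j}x_i$. Schur character: let $Y=(y_{i,j})_{1\le i,j\le n}$ be a matrix of indeterminates. For $C$ with $|C_j|=|D_j|$ for all $j$, let $Y_{D_j}^{C_j}$ be the submatrix of $Y$ with row set $C_j$ and column set $D_j$ (in increasing order; the empty determinant is $1$). The Weyl module is $$\mathbb{W}_D=\mathrm{Span}_{\mathbb{C}}\Big\{\prod_{j=1}^n\det\big(Y_{D_j}^{C_j}\big)\ :\ C_j\subseteq[n],\ |C_j|=|D_j|\text{ for all }j\Big\}\subset\mathbb{C}[Y],$$ with $GL_n(\mathbb{C})$ acting by $f(Y)\cdot g=f(g^{-1}Y)$. For a $GL_n(\mathbb{C})$-module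 $N$, $\mathrm{char}(N)(x_1,\ldots,x_n)$ is the trace on $N$ of the diagonal matrix with entries $x_1,\ldots,x_n$. The Schur character is $\chi_D(x_1,\ldots,x_n)=\mathrm{char}(\mathbb{W}_D)(x_1^{-1},\ldots,x_n^{-1})$. Stanley symmetric function: the convention is that $F_w$ is the Schur function of the Rothe diagram, $F_w=s_{D(w)}$; in the $n$ variables $\mathbf{x}=(x_1,\ldots,x_n)$ this is the Schur character, $F_w(x_1,\ldots,x_n)=\chi_{D(w)}(x_1,\ldots,x_n)$. "$F_w$ attains the lower bound" means that, with $D=D(w)$, $$\chi_{D}(\mathbf{x})=\sum_{\mathbf{x}^a\in\{\mathbf{x}^C:\ |C_j|=|D_j|\ \forall j\in[n]\}}\mathbf{x}^a,$$ the sum over the set of distinct monomials of the form $\mathbf{x}^C$. *)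

theory Defs
  imports
    "HOL-Library.Poly_Mapping"
    "HOL-Combinatorics.Permutations"
    "Jordan_Normal_Form.Determinant"
    "Jordan_Normal_Form.Gauss_Jordan_Elimination"
    "Jordan_Normal_Form.DL_Submatrix"
begin

text \<open>
  Throughout, the index set \<open>[n] = {1, ..., n}\<close> is represented by \<open>{..<n}\<close>, as in the matrix library.
  Permutations act on \<open>{..<n}\<close> accordingly; all notions below depend only on the order of the
  indices and are unaffected by this shift.
\<close>

section \<open>Complex polynomials in variables of type \<open>'v\<close>\<close>

type_synonym 'v mpoly = "('v \<Rightarrow>\<^sub>0 nat) \<Rightarrow>\<^sub>0 complex"

definition pconst :: "complex \<Rightarrow> 'v mpoly" where
  "pconst c = Poly_Mapping.single 0 c"

definition pvar :: "'v \<Rightarrow> 'v mpoly" where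
  "pvar v = Poly_Mapping.single (Poly_Mapping.single v 1) 1"

definition pscale :: "complex \<Rightarrow> 'v mpoly \<Rightarrow> 'v mpoly" where
  "pscale c p = pconst c * p"

text \<open>
  The value of \<open>p\<close> when every coefficient \<open>c\<close> is mapped to \<open>\<kappa> c\<close> and every variable \<open>v\<close> is
  replaced by \<open>\<sigma> v\<close>: evaluation for \<open>\<kappa> = id\<close>, substitution of polynomials for \<open>\<kappa> = pconst\<close>.
\<close>
definition insertion :: "(complex \<Rightarrow> 'r) \<Rightarrow> ('v \<Rightarrow> 'r) \<Rightarrow> 'v mpoly \<Rightarrow> 'r::comm_ring_1" where
  "insertion \<kappa> \<sigma> p =
     (\<Sum>m \<in> Poly_Mapping.keys p. \<kappa> (Poly_Mapping.lookup p m) *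
        (\<Prod>v \<in> Poly_Mapping.keys m. \<sigma> v ^ Poly_Mapping.lookup m v))"

abbreviation peval :: "('v \<Rightarrow> complex) \<Rightarrow> 'v mpoly \<Rightarrow> complex" where
  "peval \<equiv> insertion id"

abbreviation psubst :: "('v \<Rightarrow> 'u mpoly) \<Rightarrow> 'v mpoly \<Rightarrow> 'u mpoly" where
  "psubst \<equiv> insertion pconst"

lemma vector_space_pscale: "vector_space pscale"
proof
  fix a b :: complex and p q :: "'v mpoly"
  show "pscale a (p + q) = pscale a p + pscale a q"
    by (simp add: pscale_def distrib_left)
  show "pscale (a + b) p = pscale a p + pscale b p"
    by (simp add: pscale_def pconst_def single_add distrib_right)
  show "pscale a (pscale b p) = pscale (a * b) p"
    by (simp add: pscale_def pconst_def mult_single flip: mult.assoc)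
  show "pscale 1 p = p"
    by (simp add: pscale_def pconst_def)
qed

global_interpretation mpoly: vector_space "pscale :: complex \<Rightarrow> 'v mpoly \<Rightarrow> 'v mpoly"
  by (rule vector_space_pscale)

text \<open>
  The trace of a linear operator \<open>T\<close> on a finite-dimensional invariant subspace \<open>N\<close>, as the sum of
  the diagonal coefficients with respect to a basis of \<open>N\<close>.
\<close>
definition trace_on :: "'v mpoly set \<Rightarrow> ('v mpoly \<Rightarrow> 'v mpoly) \<Rightarrow> complex" where
  "trace_on N T =
     (let B = (SOME B. mpoly.independent B \<and> mpoly.span B = N)
      in \<Sum>b\<in>B. mpoly.representation B (T b) b)"

section \<open>Diagrams, Weyl modules and Schur characters\<close>

type_synonym diagram = "(nat \<times> nat) set"

definition column :: "diagram \<Rightarrow> nat \<Rightarrow> nat set" where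
  "column D j = {i. (i, j) \<in> D}"

definition rothe :: "nat \<Rightarrow> (nat \<Rightarrow> nat) \<Rightarrow> diagram" where
  "rothe n w = {(i, j). i < n \<and> j < n \<and> j < w i \<and> i < inv_into UNIV w j}"

text \<open>
  The diagrams \<open>C \<subseteq> [n]\<^sup>2\<close> with \<open>|C\<^sub>j| = |D\<^sub>j|\<close> for all \<open>j\<close>, given by their columns.
  Only the values \<open>C j\<close> with \<open>j < n\<close> matter.
\<close>
definition same_column_sizes :: "nat \<Rightarrow> diagram \<Rightarrow> (nat \<Rightarrow> nat set) set" where
  "same_column_sizes n D = {C. \<forall>j<n. C j \<subseteq> {..<n} \<and> card (C j) = card (column D j)}"

definition Y_mat :: "nat \<Rightarrow> (nat \<times> nat) mpoly mat" where
  "Y_mat n = mat n n pvar"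

definition weyl_module :: "nat \<Rightarrow> diagram \<Rightarrow> (nat \<times> nat) mpoly set" where
  "weyl_module n D = mpoly.span
     {(\<Prod>j<n. det (submatrix (Y_mat n) (C j) (column D j))) | C. C \<in> same_column_sizes n D}"

text \<open>The action \<open>f(Y) \<cdot> g = f(g\<^sup>-\<^sup>1 Y)\<close> of an invertible \<open>n \<times> n\<close> matrix \<open>g\<close>.\<close>
definition gl_act :: "nat \<Rightarrow> complex mat \<Rightarrow> (nat \<times> nat) mpoly \<Rightarrow> (nat \<times> nat) mpoly" where
  "gl_act n g f =
     psubst (\<lambda>(i, j). (map_mat pconst (the (mat_inverse g)) * Y_mat n) $$ (i, j)) f"

text \<open>Characters are functions on the torus of points \<open>x\<close> with \<open>x i \<noteq> 0\<close> for all \<open>i < n\<close>.\<close>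
definition weyl_char :: "nat \<Rightarrow> diagram \<Rightarrow> (nat \<Rightarrow> complex) \<Rightarrow> complex" where
  "weyl_char n D x = trace_on (weyl_module n D) (gl_act n (mat_diag n x))"

definition schur_char :: "nat \<Rightarrow> diagram \<Rightarrow> (nat \<Rightarrow> complex) \<Rightarrow> complex" where
  "schur_char n D x = weyl_char n D (\<lambda>i. inverse (x i))"

definition torus :: "nat \<Rightarrow> (nat \<Rightarrow> complex) set" where
  "torus n = {x. \<forall>i<n. x i \<noteq> 0}"

section \<open>Stanley symmetric functions\<close>

definition stanley :: "nat \<Rightarrow> (nat \<Rightarrow> nat) \<Rightarrow> (nat \<Rightarrow> complex) \<Rightarrow> complex" where
  "stanley n w = schur_char n (rothe n w)"

definition diagram_monomial :: "nat \<Rightarrow> (nat \<Rightarrow> nat set) \<Rightarrow> nat mpoly" where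
  "diagram_monomial n C = (\<Prod>j<n. \<Prod>i\<in>C j. pvar i)"

text \<open>The sum ranges over a set of polynomials, so that each distinct monomial occurs once.\<close>
definition attains_lower_bound :: "nat \<Rightarrow> (nat \<Rightarrow> nat) \<Rightarrow> bool" where
  "attains_lower_bound n w \<longleftrightarrow>
     (\<forall>x \<in> torus n. stanley n w x =
        peval x (\<Sum>m \<in> diagram_monomial n ` same_column_sizes n (rothe n w). m))"

text \<open>
  A polynomial in the variables \<open>x\<^sub>i\<close>, \<open>i < n\<close>, is determined by its values on the torus, so there is
  at most one \<open>p\<close> as below: the monomial expansion of \<open>F\<^sub>w(x\<^sub>0, ..., x\<^sub>n\<^sub>-\<^sub>1)\<close>.
\<close>
definition is_monomial_expansion :: "nat \<Rightarrow> ((nat \<Rightarrow> complex) \<Rightarrow> complex) \<Rightarrow> nat mpoly \<Rightarrow> bool" where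
  "is_monomial_expansion n f p \<longleftrightarrow>
     (\<forall>m \<in> Poly_Mapping.keys p. Poly_Mapping.keys m \<subseteq> {..<n}) \<and>
     (\<forall>x \<in> torus n. f x = peval x p)"

definition zero_one_coefficients :: "nat \<Rightarrow> (nat \<Rightarrow> nat) \<Rightarrow> bool" where
  "zero_one_coefficients n w \<longleftrightarrow>
     (\<exists>p. is_monomial_expansion n (stanley n w) p \<and> (\<forall>m. Poly_Mapping.lookup p m \<in> {0, 1}))"

section \<open>Pattern avoidance\<close>

definition contains_pattern :: "nat \<Rightarrow> (nat \<Rightarrow> nat) \<Rightarrow> nat list \<Rightarrow> bool" where
  "contains_pattern n w v \<longleftrightarrow>
     (\<exists>\<iota>. strict_mono_on {..<length v} \<iota> \<and> \<iota> ` {..<length v} \<subseteq> {..<n} \<and>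
          (\<forall>a<length v. \<forall>b<length v. w (\<iota> a) < w (\<iota> b) \<longleftrightarrow> v ! a < v ! b))"

abbreviation avoids_pattern :: "nat \<Rightarrow> (nat \<Rightarrow> nat) \<Rightarrow> nat list \<Rightarrow> bool" where
  "avoids_pattern n w v \<equiv> \<not> contains_pattern n w v"

end

theory Submission
  imports Defs "HOL-Library.Product_Lexorder"
begin

text \<open>
  The products of minors are weight vectors for the torus, so \<open>\<chi>\<^sub>D\<close> counts, for each monomial, the
  members of a basis of such products with this weight. Products of minors never vanish; hence both
  conditions on \<open>F\<^sub>w\<close> say that any two products of the same weight are proportional. This is clear if
  \<open>D(w)\<close> lies in one row or one column. Otherwise there are two boxes in different rows and columns,
  and exchanging one row index between the minors of these two columns yields a product
  of the same weight that is not proportional to the original one. Finally, boxes of \<open>D(w)\<close>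
  are inversions of \<open>w\<close>, and two inversions with different first and different second positions
  exist exactly when \<open>w\<close> contains one of the five patterns.
\<close>

section \<open>Evaluation and substitution\<close>

lemma sum_single_lookup:
  fixes p :: "'a \<Rightarrow>\<^sub>0 'b::comm_monoid_add"
  shows "(\<Sum>m\<in>Poly_Mapping.keys p. Poly_Mapping.single m (Poly_Mapping.lookup p m)) = p"
  by (rule poly_mapping_eqI) (auto simp: lookup_sum lookup_single when_def in_keys_iff)

definition monomial_value :: "('v \<Rightarrow> 'r) \<Rightarrow> ('v \<Rightarrow>\<^sub>0 nat) \<Rightarrow> 'r::comm_ring_1" where
  "monomial_value \<sigma> m = (\<Prod>v \<in> Poly_Mapping.keys m. \<sigma> v ^ Poly_Mapping.lookup m v)"

lemma monomial_value_superset: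
  assumes "finite V" "Poly_Mapping.keys m \<subseteq> V"
  shows "monomial_value \<sigma> m = (\<Prod>v\<in>V. \<sigma> v ^ Poly_Mapping.lookup m v)"
  unfolding monomial_value_def
  by (rule prod.mono_neutral_left) (use assms in \<open>auto simp: in_keys_iff\<close>)

lemma monomial_value_0 [simp]: "monomial_value \<sigma> 0 = 1"
  by (simp add: monomial_value_def)

lemma monomial_value_add: "monomial_value \<sigma> (m + m') = monomial_value \<sigma> m * monomial_value \<sigma> m'"
proof -
  let ?V = "Poly_Mapping.keys m \<union> Poly_Mapping.keys m'"
  have "monomial_value \<sigma> (m + m') = (\<Prod>v\<in>?V. \<sigma> v ^ Poly_Mapping.lookup (m + m') v)"
    by (rule monomial_value_superset) (use keys_add[of m m'] in auto)
  also have "\<dots> = (\<Prod>v\<in>?V. \<sigma> v ^ Poly_Mapping.lookup m v) * (\<Prod>v\<in>?V. \<sigma> v ^ Poly_Mapping.lookup m' v)"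
    by (simp add: lookup_add power_add prod.distrib)
  also have "\<dots> = monomial_value \<sigma> m * monomial_value \<sigma> m'"
    by (subst (1 2) monomial_value_superset[of ?V]) auto
  finally show ?thesis .
qed

context
  fixes \<kappa> :: "complex \<Rightarrow> 'r::comm_ring_1" and \<sigma> :: "'v \<Rightarrow> 'r"
  assumes \<kappa>: "comm_ring_hom \<kappa>"
begin

interpretation \<kappa>: comm_ring_hom \<kappa>
  by (rule \<kappa>)

text \<open>Extra monomials have coefficient 0, so several polynomials can be expanded over one
  common index set.\<close>

lemma insertion_superset:
  assumes "finite S" "Poly_Mapping.keys p \<subseteq> S"
  shows "insertion \<kappa> \<sigma> p = (\<Sum>m\<in>S. \<kappa> (Poly_Mapping.lookup p m) * monomial_value \<sigma> m)"
  unfolding insertion_def monomial_value_def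
  by (rule sum.mono_neutral_left) (use assms in \<open>auto simp: in_keys_iff\<close>)

lemma insertion_add: "insertion \<kappa> \<sigma> (p + q) = insertion \<kappa> \<sigma> p + insertion \<kappa> \<sigma> q"
proof -
  let ?S = "Poly_Mapping.keys p \<union> Poly_Mapping.keys q"
  show ?thesis
    using keys_add[of p q]
    by (subst (1 2 3) insertion_superset[of ?S])
      (auto simp: lookup_add \<kappa>.hom_add distrib_right sum.distrib)
qed

lemma insertion_0: "insertion \<kappa> \<sigma> 0 = 0"
  by (simp add: insertion_def)

lemma insertion_sum: "insertion \<kappa> \<sigma> (\<Sum>a\<in>A. f a) = (\<Sum>a\<in>A. insertion \<kappa> \<sigma> (f a))"
  by (induction A rule: infinite_finite_induct) (simp_all add: insertion_0 insertion_add)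

lemma insertion_single: "insertion \<kappa> \<sigma> (Poly_Mapping.single m c) = \<kappa> c * monomial_value \<sigma> m"
  by (subst insertion_superset[of "{m}"]) auto

lemma insertion_mult: "insertion \<kappa> \<sigma> (p * q) = insertion \<kappa> \<sigma> p * insertion \<kappa> \<sigma> q"
proof -
  let ?s = "\<lambda>p m. Poly_Mapping.single m (Poly_Mapping.lookup p m)"
  \<comment> \<open>Both factors are expanded into single terms, where multiplicativity is that of
    \<open>\<kappa>\<close> and of \<open>monomial_value\<close>.\<close>
  have "insertion \<kappa> \<sigma> (p * q)
      = insertion \<kappa> \<sigma> ((\<Sum>m\<in>Poly_Mapping.keys p. ?s p m) * (\<Sum>m\<in>Poly_Mapping.keys q. ?s q m))"
    by (simp only: sum_single_lookup)
  also have "\<dots> = insertion \<kappa> \<sigma> (\<Sum>m\<in>Poly_Mapping.keys p. ?s p m) * 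
      insertion \<kappa> \<sigma> (\<Sum>m\<in>Poly_Mapping.keys q. ?s q m)"
    by (simp add: sum_product insertion_sum mult_single insertion_single \<kappa>.hom_mult
        monomial_value_add mult_ac)
  finally show ?thesis by (simp only: sum_single_lookup)
qed

lemma insertion_hom: "comm_ring_hom (insertion \<kappa> \<sigma>)"
proof
  show "insertion \<kappa> \<sigma> 1 = 1"
    using insertion_single[of 0 1] by (simp add: \<kappa>.hom_one flip: single_one)
qed (simp_all add: insertion_0 insertion_add insertion_mult)

lemma insertion_pvar: "insertion \<kappa> \<sigma> (pvar v) = \<sigma> v"
  by (simp add: pvar_def insertion_single \<kappa>.hom_one monomial_value_def)

lemma insertion_pconst: "insertion \<kappa> \<sigma> (pconst c) = \<kappa> c"
  by (simp add: pconst_def insertion_single)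

end

lemma pconst_hom: "comm_ring_hom pconst"
  by standard (simp_all add: pconst_def single_add mult_single)

lemma id_hom: "comm_ring_hom (id :: complex \<Rightarrow> complex)"
  by standard auto

section \<open>Traces and minors\<close>

text \<open>Basis independence of the trace. \<open>trace_on\<close> uses an arbitrary basis
  \<open>A\<close>; expanding \<open>a\<close> in \<open>B\<close> before applying \<open>T\<close>,
  and \<open>T b\<close> in \<open>A\<close>, turns both traces into the same double sum over
  \<open>A\<close> and \<open>B\<close>.\<close>

lemma trace_on_span:
  fixes T :: "'v mpoly \<Rightarrow> 'v mpoly"
  assumes lin: "Vector_Spaces.linear pscale pscale T"
    and B: "mpoly.independent B" "finite B"
    and T: "\<And>b. b \<in> B \<Longrightarrow> T b \<in> mpoly.span B"
  shows "trace_on (mpoly.span B) T = (\<Sum>b\<in>B. mpoly.representation B (T b) b)"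
proof -
  interpret T: Vector_Spaces.linear pscale pscale T by (rule lin)
  define A where "A = (SOME A. mpoly.independent A \<and> mpoly.span A = mpoly.span B)"
  have "mpoly.independent A \<and> mpoly.span A = mpoly.span B"
    unfolding A_def by (rule someI[where x = B]) (use B in auto)
  then have A: "mpoly.independent A" "mpoly.span A = mpoly.span B" by auto
  have "finite A"
    using mpoly.independent_span_bound[OF B(2) A(1)] mpoly.span_superset[of A] A(2) by auto
  have TS: "T v \<in> mpoly.span B" if "v \<in> mpoly.span B" for v
    using that
  proof (induction rule: mpoly.span_induct_alt)
    case base
    then show ?case by (simp add: T.zero mpoly.span_zero)
  next
    case (step c x y)
    then show ?case by (simp add: T.add T.scale mpoly.span_add mpoly.span_scale T)
  qed
  have A_in: "a \<in> mpoly.span B" if "a \<in> A" for a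
    using that A(2) mpoly.span_base by auto
  have B_in: "b \<in> mpoly.span B" if "b \<in> B" for b
    using that mpoly.span_base by auto
  have 1: "mpoly.representation A (T a) a =
      (\<Sum>b\<in>B. mpoly.representation B a b * mpoly.representation A (T b) a)" if "a \<in> A" for a
  proof -
    have "T a = T (\<Sum>b\<in>B. pscale (mpoly.representation B a b) b)"
      using A_in[OF that] B by (simp add: mpoly.sum_representation_eq)
    also have "\<dots> = (\<Sum>b\<in>B. pscale (mpoly.representation B a b) (T b))"
      by (simp add: T.sum T.scale)
    finally show ?thesis
      using A TS B_in by (simp add: mpoly.representation_sum mpoly.representation_scale
          mpoly.span_scale)
  qed
  have 2: "mpoly.representation B (T b) b =
      (\<Sum>a\<in>A. mpoly.representation A (T b) a * mpoly.representation B a b)" if "b \<in> B" for b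
  proof -
    have "T b = (\<Sum>a\<in>A. pscale (mpoly.representation A (T b) a) a)"
      using that A \<open>finite A\<close> T by (simp add: mpoly.sum_representation_eq)
    then have "mpoly.representation B (T b) =
        mpoly.representation B (\<Sum>a\<in>A. pscale (mpoly.representation A (T b) a) a)" by simp
    then show ?thesis
      using B A_in by (simp add: mpoly.representation_sum mpoly.representation_scale
          mpoly.span_scale)
  qed
  have "trace_on (mpoly.span B) T = (\<Sum>a\<in>A. mpoly.representation A (T a) a)"
    by (simp add: trace_on_def A_def Let_def)
  also have "\<dots> = (\<Sum>b\<in>B. mpoly.representation B (T b) b)"
    by (simp add: 1 2 mult.commute) (rule sum.swap)
  finally show ?thesis .
qed

section \<open>Minors and the effect of substitutions on them\<close>

lemma bij_betw_pick: "finite A \<Longrightarrow> bij_betw (pick A) {..<card A} A"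
proof -
  assume "finite A"
  have inj: "inj_on (pick A) {..<card A}"
    by (rule strict_mono_on_imp_inj_on) (auto simp: strict_mono_on_def intro: pick_mono_le)
  moreover have "pick A ` {..<card A} = A"
    by (rule card_subset_eq[OF \<open>finite A\<close>]) (auto simp: card_image[OF inj] pick_in_set_le)
  ultimately show ?thesis by (simp add: bij_betw_def)
qed

definition minor :: "nat \<Rightarrow> nat set \<Rightarrow> nat set \<Rightarrow> (nat \<times> nat) mpoly" where
  "minor n A B = det (submatrix (Y_mat n) A B)"

lemma submatrix_mat:
  assumes "A \<subseteq> {..<n}" "B \<subseteq> {..<n}"
  shows "submatrix (mat n n f) A B = mat (card A) (card B) (\<lambda>(i, j). f (pick A i, pick B j))"
proof -
  have *: "{i. i < n \<and> i \<in> A} = A" "{i. i < n \<and> i \<in> B} = B" using assms by auto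
  have "pick A i < n" if "i < card A" for i
    using pick_in_set_le[OF that] assms by auto
  moreover have "pick B i < n" if "i < card B" for i
    using pick_in_set_le[OF that] assms by auto
  ultimately show ?thesis
    by (auto simp: submatrix_def * intro!: cong_mat)
qed

lemma insertion_minor:
  assumes "comm_ring_hom \<kappa>" "A \<subseteq> {..<n}" "B \<subseteq> {..<n}"
  shows "insertion \<kappa> \<sigma> (minor n A B) =
    det (mat (card A) (card B) (\<lambda>(i, j). \<sigma> (pick A i, pick B j)))"
proof -
  interpret comm_ring_hom "insertion \<kappa> \<sigma>" by (rule insertion_hom[OF assms(1)])
  have "insertion \<kappa> \<sigma> (minor n A B) = det (map_mat (insertion \<kappa> \<sigma>) (submatrix (Y_mat n) A B))"
    by (simp add: minor_def)
  also have "map_mat (insertion \<kappa> \<sigma>) (submatrix (Y_mat n) A B) =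
      mat (card A) (card B) (\<lambda>(i, j). \<sigma> (pick A i, pick B j))"
    by (rule eq_matI) (auto simp: Y_mat_def submatrix_mat[OF assms(2,3)] insertion_pvar[OF assms(1)])
  finally show ?thesis .
qed

lemma det_mat_diag: "det (mat_diag k f) = (\<Prod>i<k. f i)"
proof -
  have "det (mat_diag k f) = prod_list (diag_mat (mat_diag k f))"
    by (rule det_upper_triangular[where n = k]) (auto simp: mat_diag_def upper_triangular_def)
  also have "diag_mat (mat_diag k f) = map f [0..<k]"
    by (auto simp: diag_mat_def mat_diag_def)
  also have "prod_list \<dots> = (\<Prod>i<k. f i)"
    by (simp add: prod.distinct_set_conv_list[symmetric] atLeast0LessThan)
  finally show ?thesis .
qed

section \<open>Generators, weights and the torus action\<close>

definition weyl_generator :: "nat \<Rightarrow> diagram \<Rightarrow> (nat \<Rightarrow> nat set) \<Rightarrow> (nat \<times> nat) mpoly" where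
  "weyl_generator n D C = (\<Prod>j<n. minor n (C j) (column D j))"

lemma weyl_module_eq_span: "weyl_module n D = mpoly.span (weyl_generator n D ` same_column_sizes n D)"
  by (simp add: weyl_module_def weyl_generator_def minor_def image_def setcompr_eq_image) 

text \<open>The exponent vector of \<open>diagram_monomial n C\<close>.\<close>

definition weight :: "nat \<Rightarrow> (nat \<Rightarrow> nat set) \<Rightarrow> nat \<Rightarrow>\<^sub>0 nat" where
  "weight n C = (\<Sum>j<n. \<Sum>i\<in>C j. Poly_Mapping.single i 1)"

lemma prod_single: "(\<Prod>a\<in>A. Poly_Mapping.single (f a) (1::complex)) = Poly_Mapping.single (\<Sum>a\<in>A. f a) 1"
  by (induction A rule: infinite_finite_induct) (simp_all add: mult_single single_one)

lemma diagram_monomial_eq: "diagram_monomial n C = Poly_Mapping.single (weight n C) 1"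
  by (simp add: diagram_monomial_def weight_def pvar_def prod_single)

lemma diagram_monomial_eq_iff: "diagram_monomial n C = diagram_monomial n C' \<longleftrightarrow> weight n C = weight n C'"
proof
  assume "diagram_monomial n C = diagram_monomial n C'"
  then have "Poly_Mapping.keys (Poly_Mapping.single (weight n C) (1::complex)) =
      Poly_Mapping.keys (Poly_Mapping.single (weight n C') (1::complex))"
    by (simp only: diagram_monomial_eq)
  then show "weight n C = weight n C'" by simp
qed (simp add: diagram_monomial_eq)

lemma keys_weight_subset:
  assumes "C \<in> same_column_sizes n D"
  shows "Poly_Mapping.keys (weight n C) \<subseteq> {..<n}"
proof (rule subsetI, rule ccontr)
  fix i assume i: "i \<in> Poly_Mapping.keys (weight n C)" "i \<notin> {..<n}"
  then have "i \<notin> C j" if "j < n" for j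
    using assms that by (auto simp: same_column_sizes_def)
  then have "Poly_Mapping.lookup (weight n C) i = 0"
    unfolding weight_def lookup_sum by (intro sum.neutral ballI) (auto simp: lookup_single when_def)
  then show False using i by (simp add: in_keys_iff)
qed

lemma peval_diagram_monomial: "peval x (diagram_monomial n C) = (\<Prod>j<n. \<Prod>i\<in>C j. x i)"
proof -
  interpret comm_ring_hom "peval x" by (rule insertion_hom[OF id_hom])
  show ?thesis by (simp add: diagram_monomial_def hom_prod insertion_pvar[OF id_hom])
qed

text \<open>The map from f(Y) to f(diag(x) Y), that is, the action of the inverse of diag(x),
  written without a matrix inverse and without a bound on the indices.\<close>

definition row_scaling :: "(nat \<Rightarrow> complex) \<Rightarrow> (nat \<times> nat) mpoly \<Rightarrow> (nat \<times> nat) mpoly" where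
  "row_scaling x = psubst (\<lambda>(i, j). pconst (x i) * pvar (i, j))"

lemma row_scaling_linear: "Vector_Spaces.linear pscale pscale (row_scaling x)"
  by (simp add: Vector_Spaces.linear_iff vector_space_pscale row_scaling_def insertion_add pconst_hom
      pscale_def insertion_mult insertion_pconst)

lemma row_scaling_minor:
  assumes "A \<subseteq> {..<n}" "B \<subseteq> {..<n}" "card A = card B"
  shows "row_scaling x (minor n A B) = pconst (\<Prod>i\<in>A. x i) * minor n A B"
proof -
  interpret pconst: comm_ring_hom pconst by (rule pconst_hom)
  let ?k = "card B"
  let ?S = "mat ?k ?k (\<lambda>(i, j). pvar (pick A i, pick B j))"
  have "row_scaling x (minor n A B) = det (mat ?k ?k (\<lambda>(i, j). pconst (x (pick A i)) * pvar (pick A i, pick B j)))"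
    by (simp add: row_scaling_def insertion_minor[OF pconst_hom assms(1,2)] assms(3))
  \<comment> \<open>Scaling rows is left multiplication by a diagonal matrix, whose determinant is
    split off by \<open>det_mult\<close>.\<close>
  also have "mat ?k ?k (\<lambda>(i, j). pconst (x (pick A i)) * pvar (pick A i, pick B j)) =
      mat_diag ?k (\<lambda>i. pconst (x (pick A i))) * ?S"
    by (subst mat_diag_mult_left[of _ ?k ?k]) (auto intro!: cong_mat)
  also have "det \<dots> = (\<Prod>i<?k. pconst (x (pick A i))) * det ?S"
    by (subst det_mult[of _ ?k]) (simp_all add: det_mat_diag)
  also have "(\<Prod>i<?k. pconst (x (pick A i))) = pconst (\<Prod>i\<in>A. x i)"
    using prod.reindex_bij_betw[OF bij_betw_pick, of A "\<lambda>i. pconst (x i)"] assms finite_subset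
    by (auto simp: pconst.hom_prod)
  also have "?S = submatrix (Y_mat n) A B"
    using assms by (simp add: Y_mat_def submatrix_mat)
  finally show ?thesis by (simp add: minor_def)
qed

lemma row_scaling_weyl_generator:
  assumes "C \<in> same_column_sizes n D" "\<And>j. j < n \<Longrightarrow> column D j \<subseteq> {..<n}"
  shows "row_scaling x (weyl_generator n D C) = pscale (peval x (diagram_monomial n C)) (weyl_generator n D C)"
proof -
  interpret pconst: comm_ring_hom "pconst :: complex \<Rightarrow> 'v mpoly" by (rule pconst_hom)
  interpret comm_ring_hom "row_scaling x"
    unfolding row_scaling_def by (rule insertion_hom[OF pconst_hom])
  have "row_scaling x (weyl_generator n D C) =
      (\<Prod>j<n. pconst (\<Prod>i\<in>C j. x i) * minor n (C j) (column D j))"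
    unfolding weyl_generator_def hom_prod
    by (rule prod.cong) (use assms in \<open>auto simp: same_column_sizes_def row_scaling_minor\<close>)
  then show ?thesis
    by (simp add: weyl_generator_def prod.distrib pscale_def peval_diagram_monomial pconst.hom_prod)
qed

text \<open>\<open>mat_inverse\<close> is computed by elimination, so its value is identified
  indirectly: it is not \<open>None\<close> because the matrix is a unit, and inverses are
  unique.\<close>

lemma mat_inverse_mat_diag:
  fixes x :: "nat \<Rightarrow> complex"
  assumes "x \<in> torus n"
  shows "mat_inverse (mat_diag n (\<lambda>i. inverse (x i))) = Some (mat_diag n x)"
proof -
  let ?A = "mat_diag n (\<lambda>i. inverse (x i))" and ?B = "mat_diag n x"
  have AB: "?A * ?B = 1\<^sub>m n" "?B * ?A = 1\<^sub>m n"
    using assms unfolding mat_diag_diag by (auto simp: torus_def mat_diag_def one_mat_def intro!: cong_mat)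
  have "?A \<in> Units (ring_mat TYPE(complex) n ())"
    using AB by (auto simp: Units_def ring_mat_def intro!: bexI[of _ ?B])
  then obtain C where C: "mat_inverse ?A = Some C"
    using mat_inverse(1)[of ?A n "()"] by (cases "mat_inverse ?A") auto
  then have CA: "?A * C = 1\<^sub>m n" "C \<in> carrier_mat n n"
    using mat_inverse(2)[of ?A n] by auto
  have "C = ?B * ?A * C" using CA(2) by (simp only: AB left_mult_one_mat)
  also have "\<dots> = ?B * (?A * C)" using CA by (intro assoc_mult_mat[of _ n n _ n _ n]) auto
  also have "\<dots> = ?B" unfolding CA(1) by (rule right_mult_one_mat[OF mat_diag_dim])
  finally show ?thesis using C by simp
qed

text \<open>The inverse in the action cancels the one in the Schur character. The entries of
  \<open>?M\<close> are known only for indices below \<open>n\<close>, so the two substitutions are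
  compared on minors with rows and columns in \<open>{..<n}\<close>.\<close>

lemma gl_act_weyl_generator:
  assumes "x \<in> torus n"
    and "C \<in> same_column_sizes n D" "\<And>j. j < n \<Longrightarrow> column D j \<subseteq> {..<n}"
  shows "gl_act n (mat_diag n (\<lambda>i. inverse (x i))) (weyl_generator n D C) = row_scaling x (weyl_generator n D C)"
proof -
  let ?M = "map_mat pconst (mat_diag n x) * Y_mat n"
  let ?T = "psubst (($$) ?M)"
  interpret pconst: comm_ring_hom "pconst :: complex \<Rightarrow> (nat \<times> nat) mpoly" by (rule pconst_hom)
  interpret T: comm_ring_hom ?T by (rule insertion_hom[OF pconst_hom])
  interpret R: comm_ring_hom "row_scaling x"
    unfolding row_scaling_def by (rule insertion_hom[OF pconst_hom])
  have "map_mat pconst (mat_diag n x) = mat_diag n (\<lambda>i. pconst (x i) :: (nat \<times> nat) mpoly)"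
    by (rule eq_matI) (auto simp: mat_diag_def pconst_def)
  then have M: "?M $$ (i, j) = pconst (x i) * pvar (i, j)" if "i < n" "j < n" for i j
    using that by (simp add: mat_diag_mult_left[of _ n n] Y_mat_def)
  have "?T (minor n A B) = row_scaling x (minor n A B)"
    if "A \<subseteq> {..<n}" "B \<subseteq> {..<n}" for A B
  proof -
    have "pick A i < n" if "i < card A" for i
      using pick_in_set_le[OF that] \<open>A \<subseteq> {..<n}\<close> by auto
    moreover have "pick B i < n" if "i < card B" for i
      using pick_in_set_le[OF that] \<open>B \<subseteq> {..<n}\<close> by auto
    ultimately show ?thesis
      unfolding row_scaling_def insertion_minor[OF pconst_hom that]
      by (intro arg_cong[of _ _ det]) (auto simp: M intro!: cong_mat)
  qed
  then show ?thesis
    using assms by (auto simp: gl_act_def mat_inverse_mat_diag weyl_generator_def T.hom_prod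
        R.hom_prod same_column_sizes_def intro!: prod.cong)
qed

section \<open>The monomial expansion of a Schur character\<close>

definition spike :: "nat \<Rightarrow> nat \<Rightarrow> complex" where
  "spike i k = (if k = i then 2 else 1)"

lemma spike_torus: "spike i \<in> torus n"
  by (simp add: spike_def torus_def)

lemma monomial_value_spike: "monomial_value (spike i) m = 2 ^ Poly_Mapping.lookup m i"
proof -
  have "monomial_value (spike i) m =
      (\<Prod>k\<in>insert i (Poly_Mapping.keys m). spike i k ^ Poly_Mapping.lookup m k)"
    by (rule monomial_value_superset) auto
  also have "\<dots> = (\<Prod>k\<in>insert i (Poly_Mapping.keys m). if k = i then 2 ^ Poly_Mapping.lookup m k else 1)"
    by (rule prod.cong) (auto simp: spike_def)
  finally show ?thesis by simp
qed

text \<open>Some exponent differs, and the spike at this variable detects it because the powers of 2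
  are distinct.\<close>

lemma monomial_value_spike_neq:
  assumes "m \<noteq> m'"
  obtains i where "monomial_value (spike i) m \<noteq> monomial_value (spike i) m'"
proof -
  obtain i where "Poly_Mapping.lookup m i \<noteq> Poly_Mapping.lookup m' i"
    using assms by (meson poly_mapping_eqI)
  then have "monomial_value (spike i) m \<noteq> monomial_value (spike i) m'"
    unfolding monomial_value_spike
    by (metis of_nat_eq_iff of_nat_numeral of_nat_power power_inject_exp one_less_numeral_iff semiring_norm(76))
  then show ?thesis using that by blast
qed

lemma monomial_value_mult: "monomial_value (\<lambda>i. x i * y i) m = monomial_value x m * monomial_value y m"
  by (simp add: monomial_value_def power_mult_distrib prod.distrib)

text \<open>Dedekind's argument for the linear independence of characters.\<close>

lemma torus_characters_independent:
  fixes c :: "(nat \<Rightarrow>\<^sub>0 nat) \<Rightarrow> complex"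
  assumes "finite S"
    and "\<And>x. x \<in> torus n \<Longrightarrow> (\<Sum>m\<in>S. c m * monomial_value x m) = 0"
    and "m \<in> S"
  shows "c m = 0"
  using assms
proof (induction S arbitrary: c m rule: finite_induct)
  case (insert m0 S)
  have S0: "c m = 0" if "m \<in> S" for m
  proof -
    have "m \<noteq> m0" using that insert.hyps by auto
    then obtain i where i: "monomial_value (spike i) m \<noteq> monomial_value (spike i) m0"
      by (rule monomial_value_spike_neq)
    let ?y = "spike i"
    let ?c = "\<lambda>m. c m * (monomial_value ?y m - monomial_value ?y m0)"
    \<comment> \<open>The relation at the product of \<open>x\<close> and \<open>?y\<close>, minus
      \<open>monomial_value ?y m0\<close> times the relation at \<open>x\<close>, has no term at
      \<open>m0\<close>.\<close>
    have "(\<Sum>m\<in>S. ?c m * monomial_value x m) = 0" if x: "x \<in> torus n" for x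
    proof -
      have xy: "(\<lambda>i. x i * ?y i) \<in> torus n"
        using x spike_torus[of i n] by (simp add: torus_def)
      have "(\<Sum>m\<in>S. ?c m * monomial_value x m) = (\<Sum>m\<in>insert m0 S. ?c m * monomial_value x m)"
        using insert.hyps by simp
      also have "\<dots> = (\<Sum>m\<in>insert m0 S. c m * monomial_value (\<lambda>i. x i * ?y i) m) -
          monomial_value ?y m0 * (\<Sum>m\<in>insert m0 S. c m * monomial_value x m)"
        unfolding sum_distrib_left sum_subtractf[symmetric] monomial_value_mult
        by (rule sum.cong) (simp_all add: algebra_simps)
      also have "\<dots> = 0"
        by (simp only: insert.prems(1)[OF x] insert.prems(1)[OF xy]) simp
      finally show ?thesis .
    qed
    then have "?c m = 0" using that by (rule insert.IH)
    then show ?thesis using i by simp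
  qed
  \<comment> \<open>At the all-ones point every monomial has value 1, so only \<open>c m0\<close> is
    left of the sum.\<close>
  moreover have "c m0 = 0"
    using insert.prems(1)[of "\<lambda>_. 1"] insert.hyps S0
    by (simp add: torus_def monomial_value_def)
  ultimately show ?case using insert.prems(2) by auto
qed simp

lemma peval_eq_sum:
  "finite S \<Longrightarrow> Poly_Mapping.keys p \<subseteq> S \<Longrightarrow>
    peval x p = (\<Sum>m\<in>S. Poly_Mapping.lookup p m * monomial_value x m)"
  by (simp add: insertion_superset[OF id_hom])

text \<open>The coefficients of the difference form a linear relation between monomials as functions
  on the torus.\<close>

lemma eq_on_torus_imp_eq:
  assumes "\<And>x. x \<in> torus n \<Longrightarrow> peval x p = peval x q"
  shows "p = q"
proof (rule poly_mapping_eqI)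
  fix m
  let ?S = "insert m (Poly_Mapping.keys p \<union> Poly_Mapping.keys q)"
  let ?c = "\<lambda>m. Poly_Mapping.lookup p m - Poly_Mapping.lookup q m"
  have eq: "(\<Sum>m\<in>?S. ?c m * monomial_value x m) = peval x p - peval x q" for x
    by (subst (1 2) peval_eq_sum[of ?S]) (auto simp: algebra_simps sum_subtractf)
  have "?c m = 0"
  proof (rule torus_characters_independent[where c = ?c and S = ?S and n = n])
    show "(\<Sum>m\<in>?S. ?c m * monomial_value x m) = 0" if "x \<in> torus n" for x
      unfolding eq using assms[OF that] by simp
  qed auto
  then show "Poly_Mapping.lookup p m = Poly_Mapping.lookup q m" by simp
qed

text \<open>The values \<open>C j\<close> with \<open>n \<le> j\<close> are arbitrary, so
  \<open>same_column_sizes n D\<close> itself need not be finite; the first \<open>n\<close> columns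
  leave only finitely many choices.\<close>

lemma finite_image_same_column_sizes:
  assumes "\<And>C. f (restrict C {..<n}) = f C"
  shows "finite (f ` same_column_sizes n D)"
proof (rule finite_subset)
  let ?P = "{..<n} \<rightarrow>\<^sub>E Pow {..<n}"
  show "f ` same_column_sizes n D \<subseteq> f ` ?P"
  proof
    fix y assume "y \<in> f ` same_column_sizes n D"
    then obtain C where C: "C \<in> same_column_sizes n D" "y = f C" by blast
    then have "y = f (restrict C {..<n})" by (simp add: assms)
    moreover have "restrict C {..<n} \<in> ?P" using C by (auto simp: same_column_sizes_def)
    ultimately show "y \<in> f ` ?P" by blast
  qed
  show "finite (f ` ?P)"
    by (intro finite_imageI finite_PiE) auto
qed

text \<open>A basis of the Weyl module made of generators. It is indexed by the column choices
  \<open>C\<close>, because the weight is read off from \<open>C\<close> rather than from the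
  polynomial.\<close>

definition weyl_basis :: "nat \<Rightarrow> diagram \<Rightarrow> (nat \<Rightarrow> nat set) set \<Rightarrow> bool" where
  "weyl_basis n D K \<longleftrightarrow> K \<subseteq> same_column_sizes n D \<and> finite K \<and> inj_on (weyl_generator n D) K \<and>
     mpoly.independent (weyl_generator n D ` K) \<and> mpoly.span (weyl_generator n D ` K) = weyl_module n D"

text \<open>A spanning set contains a basis; one column choice is kept for each basis
  vector.\<close>

lemma weyl_basis_exists: "\<exists>K. weyl_basis n D K"
proof -
  let ?G = "weyl_generator n D ` same_column_sizes n D"
  obtain B where B: "B \<subseteq> ?G" "mpoly.independent B" "?G \<subseteq> mpoly.span B"
    by (rule mpoly.maximal_independent_subset)
  then have "mpoly.span B = weyl_module n D"
    unfolding weyl_module_eq_span by (metis mpoly.span_mono mpoly.span_span subset_antisym)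
  moreover obtain K where "K \<subseteq> same_column_sizes n D" "inj_on (weyl_generator n D) K" "B = weyl_generator n D ` K"
    using B(1) by (auto simp: subset_image_inj)
  moreover have "finite B" using B(1) by (rule finite_subset)
      (rule finite_image_same_column_sizes, simp add: weyl_generator_def)
  ultimately show ?thesis
    using B(2) finite_image_iff unfolding weyl_basis_def by metis
qed

context
  fixes n :: nat and D :: diagram
  assumes D: "\<And>j. j < n \<Longrightarrow> column D j \<subseteq> {..<n}"
begin

text \<open>The basis vectors are eigenvectors of the torus whose eigenvalues are the diagram
  monomials at \<open>x\<close>; the trace is the sum of these.\<close>

lemma schur_char_eq_peval:
  assumes K: "weyl_basis n D K" and x: "x \<in> torus n"
  shows "schur_char n D x = peval x (\<Sum>C\<in>K. diagram_monomial n C)"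
proof -
  let ?f = "weyl_generator n D"
  let ?T = "gl_act n (mat_diag n (\<lambda>i. inverse (x i)))"
  have K': "K \<subseteq> same_column_sizes n D" "finite K" "inj_on ?f K" "mpoly.independent (?f ` K)"
    and span: "mpoly.span (?f ` K) = weyl_module n D"
    using K by (auto simp: weyl_basis_def)
  have mem: "?f C \<in> mpoly.span (?f ` K)" if "C \<in> K" for C
    using that by (intro mpoly.span_base imageI)
  have T: "?T (?f C) = pscale (peval x (diagram_monomial n C)) (?f C)" if "C \<in> K" for C
    using that K' x D by (simp add: gl_act_weyl_generator row_scaling_weyl_generator subset_iff)
  have "schur_char n D x = trace_on (mpoly.span (?f ` K)) ?T"
    by (simp add: schur_char_def weyl_char_def span)
  also have "\<dots> = (\<Sum>b\<in>?f ` K. mpoly.representation (?f ` K) (?T b) b)"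
  proof (rule trace_on_span)
    show "Vector_Spaces.linear pscale pscale ?T"
      by (simp add: Vector_Spaces.linear_iff vector_space_pscale gl_act_def insertion_add pconst_hom
          pscale_def insertion_mult insertion_pconst)
  qed (use K' T mem in \<open>auto intro!: mpoly.span_scale\<close>)
  also have "\<dots> = (\<Sum>C\<in>K. mpoly.representation (?f ` K) (?T (?f C)) (?f C))"
    by (simp add: sum.reindex K')
  also have "\<dots> = (\<Sum>C\<in>K. peval x (diagram_monomial n C))"
    by (rule sum.cong)
      (auto simp: T mpoly.representation_scale mpoly.representation_basis K' mem)
  also have "\<dots> = peval x (\<Sum>C\<in>K. diagram_monomial n C)"
    by (simp add: insertion_sum[OF id_hom])
  finally show ?thesis .
qed

text \<open>A weight vector involves only basis vectors of its own weight: scaling its expansion and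
  subtracting the eigenvalue times the expansion gives a linear relation on the basis, and a
  suitable spike makes the factor at a different weight nonzero.\<close>

lemma weyl_generator_in_weight_span:
  assumes K: "weyl_basis n D K" and C: "C \<in> same_column_sizes n D"
  shows "weyl_generator n D C \<in>
    mpoly.span (weyl_generator n D ` {C' \<in> K. weight n C' = weight n C})"
proof -
  let ?f = "weyl_generator n D"
  let ?a = "\<lambda>C'. mpoly.representation (?f ` K) (?f C) (?f C')"
  let ?v = "\<lambda>x C. monomial_value x (weight n C)"
  have K': "K \<subseteq> same_column_sizes n D" "finite K" "inj_on ?f K" "mpoly.independent (?f ` K)"
    and span: "mpoly.span (?f ` K) = weyl_module n D"
    using K by (auto simp: weyl_basis_def)
  have "?f C \<in> mpoly.span (?f ` K)"
    unfolding span weyl_module_eq_span using C by (intro mpoly.span_base) auto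
  then have "(\<Sum>b\<in>?f ` K. pscale (mpoly.representation (?f ` K) (?f C) b) b) = ?f C"
    by (intro mpoly.sum_representation_eq) (use K' in auto)
  then have fC: "?f C = (\<Sum>C'\<in>K. pscale (?a C') (?f C'))"
    by (simp add: sum.reindex K')
  have a0: "?a C' = 0" if C': "C' \<in> K" "weight n C' \<noteq> weight n C" for C'
  proof -
    obtain i where i: "?v (spike i) C' \<noteq> ?v (spike i) C"
      using C'(2) by (rule monomial_value_spike_neq)
    let ?x = "spike i"
    interpret R: Vector_Spaces.linear pscale pscale "row_scaling ?x" by (rule row_scaling_linear)
    have R: "row_scaling ?x (?f C) = pscale (?v ?x C) (?f C)" if "C \<in> same_column_sizes n D" for C
      using row_scaling_weyl_generator[OF that D]
      by (simp add: diagram_monomial_eq insertion_single[OF id_hom])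
    have "(\<Sum>C'\<in>K. pscale (?a C' * (?v ?x C' - ?v ?x C)) (?f C')) =
        row_scaling ?x (\<Sum>C'\<in>K. pscale (?a C') (?f C')) - pscale (?v ?x C) (\<Sum>C'\<in>K. pscale (?a C') (?f C'))"
      unfolding R.sum R.scale mpoly.scale_sum_right sum_subtractf[symmetric]
      by (rule sum.cong)
        (use K' in \<open>auto simp: R subset_iff mpoly.scale_left_diff_distrib algebra_simps\<close>)
    also have "\<dots> = 0"
      by (simp only: fC[symmetric] R[OF C]) simp
    \<comment> \<open>\<open>mpoly.independentD\<close> takes coefficients indexed by polynomials,
      hence the passage back from \<open>?f C'\<close> to \<open>C'\<close>.\<close>
    finally have "(\<Sum>b\<in>?f ` K. pscale (?a (the_inv_into K ?f b) *
        (?v ?x (the_inv_into K ?f b) - ?v ?x C)) b) = 0"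
      by (simp add: sum.reindex K' the_inv_into_f_f)
    then have "?a (the_inv_into K ?f (?f C')) * (?v ?x (the_inv_into K ?f (?f C')) - ?v ?x C) = 0"
      using K' C' by (intro mpoly.independentD[OF K'(4) _ subset_refl]) auto
    then show ?thesis using K' C' i by (simp add: the_inv_into_f_f)
  qed
  let ?K = "{C' \<in> K. weight n C' = weight n C}"
  have "(\<Sum>C'\<in>K. pscale (?a C') (?f C')) = (\<Sum>C'\<in>?K. pscale (?a C') (?f C'))"
    by (rule sum.mono_neutral_right) (use K' a0 in auto)
  also have "\<dots> \<in> mpoly.span (?f ` ?K)"
    by (intro mpoly.span_sum mpoly.span_scale mpoly.span_base imageI)
  finally show ?thesis using fC by simp
qed

end

section \<open>Proportional products of minors\<close>

text \<open>The 0-1 matrix of the map \<open>\<pi>\<close>, used as a point at which minors are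
  evaluated.\<close>

definition graph_point :: "(nat \<Rightarrow> nat) \<Rightarrow> nat \<times> nat \<Rightarrow> complex" where
  "graph_point \<pi> = (\<lambda>(r, c). if \<pi> r = c then 1 else 0)"

text \<open>The evaluated submatrix is a permutation matrix, hence orthogonal, and so
  invertible.\<close>

lemma peval_minor_graph_point_nonzero:
  assumes AB: "A \<subseteq> {..<n}" "B \<subseteq> {..<n}" and \<pi>: "bij_betw \<pi> A B"
  shows "peval (graph_point \<pi>) (minor n A B) \<noteq> 0"
proof -
  let ?k = "card B"
  have fin: "finite A" "finite B" using AB finite_subset by auto
  have card: "card A = ?k" using \<pi> by (rule bij_betw_same_card)
  define M :: "complex mat" where "M = mat ?k ?k (\<lambda>(i, j). if \<pi> (pick A i) = pick B j then 1 else 0)"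
  have M: "M \<in> carrier_mat ?k ?k" by (simp add: M_def)
  have pickA: "bij_betw (pick A) {..<?k} A" using bij_betw_pick[OF fin(1)] card by simp
  have pickB: "bij_betw (pick B) {..<?k} B" by (rule bij_betw_pick[OF fin(2)])
  have "M * transpose_mat M = 1\<^sub>m ?k"
  proof (rule eq_matI)
    fix i i' assume "i < dim_row (1\<^sub>m ?k :: complex mat)" "i' < dim_col (1\<^sub>m ?k :: complex mat)"
    then have i: "i < ?k" "i' < ?k" by auto
    have A: "pick A i \<in> A" "pick A i' \<in> A" using i pickA by (auto simp: bij_betw_def)
    then have "\<pi> (pick A i) \<in> B" using \<pi> by (auto simp: bij_betw_def)
    \<comment> \<open>The position in \<open>B\<close> of the only nonzero entry of row
      \<open>i\<close>.\<close>
    then obtain l where l: "l < ?k" "pick B l = \<pi> (pick A i)"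
      using pickB by (metis bij_betw_def imageE lessThan_iff)
    have l_iff: "\<pi> (pick A i) = pick B j \<longleftrightarrow> j = l" if "j < ?k" for j
      using that l pickB by (metis bij_betw_def inj_on_eq_iff lessThan_iff)
    have "(M * transpose_mat M) $$ (i, i') = (\<Sum>j = 0..<?k. M $$ (i, j) * M $$ (i', j))"
      using i M by (simp add: scalar_prod_def)
    also have "\<dots> = (\<Sum>j = 0..<?k. if j = l then M $$ (i', j) else 0)"
      by (rule sum.cong) (use i l_iff in \<open>auto simp: M_def\<close>)
    also have "\<dots> = M $$ (i', l)" using l by simp
    also have "\<dots> = (if \<pi> (pick A i') = \<pi> (pick A i) then 1 else 0)"
      using i l by (simp add: M_def)
    also have "\<dots> = 1\<^sub>m ?k $$ (i, i')"
      using i A \<pi> pickA by (auto simp: bij_betw_def inj_on_def)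
    finally show "(M * transpose_mat M) $$ (i, i') = 1\<^sub>m ?k $$ (i, i')" .
  qed (use M in auto)
  then have "det M * det (transpose_mat M) = 1"
    using M by (simp flip: det_mult)
  then have "det M \<noteq> 0" by auto
  then show ?thesis
    by (simp add: insertion_minor[OF id_hom AB] graph_point_def card M_def)
qed

text \<open>No row of \<open>A\<close> is sent to \<open>d\<close>, so the column of
  \<open>d\<close> vanishes.\<close>

lemma peval_minor_graph_point_zero:
  assumes AB: "A \<subseteq> {..<n}" "B \<subseteq> {..<n}" "card A = card B" and d: "d \<in> B" "d \<notin> \<pi> ` A"
  shows "peval (graph_point \<pi>) (minor n A B) = 0"
proof -
  let ?k = "card B"
  have fin: "finite A" "finite B" using AB finite_subset by auto
  define M :: "complex mat" where "M = mat ?k ?k (\<lambda>(i, j). if \<pi> (pick A i) = pick B j then 1 else 0)"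
  obtain l where l: "l < ?k" "pick B l = d"
    using bij_betw_pick[OF fin(2)] d by (metis bij_betw_def imageE lessThan_iff)
  have missed: "\<pi> (pick A i) \<noteq> d" if "i < ?k" for i
    using that d(2) pick_in_set_le[of i A] AB(3) by auto
  \<comment> \<open>Column \<open>l\<close> is already zero, so a diagonal factor with entry 0 at
    \<open>l\<close>, of determinant 0, can be split off.\<close>
  have "M = M * mat_diag ?k (\<lambda>j. if j = l then 0 else 1)"
    using l missed by (subst mat_diag_mult_right[of _ ?k]) (auto simp: M_def intro!: cong_mat)
  then have "det M = det M * det (mat_diag ?k (\<lambda>j. if j = l then 0 else 1))"
    by (metis M_def det_mult mat_carrier mat_diag_dim)
  also have "\<dots> = 0" using l by (simp add: det_mat_diag prod_zero_iff)
  finally show ?thesis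
    by (simp add: insertion_minor[OF id_hom AB(1,2)] graph_point_def AB(3) M_def)
qed

lemma minor_nonzero:
  assumes "A \<subseteq> {..<n}" "B \<subseteq> {..<n}" "card A = card B"
  shows "minor n A B \<noteq> 0"
proof
  assume 0: "minor n A B = 0"
  obtain \<pi> where "bij_betw \<pi> A B"
    using finite_same_card_bij[of A B] assms finite_subset by blast
  from peval_minor_graph_point_nonzero[OF assms(1,2) this] 0
  show False by (simp add: insertion_0[OF id_hom])
qed

text \<open>A product of nonzero polynomials is nonzero; the monomial order behind this comes from
  the lexicographic order on index pairs.\<close>

lemma weyl_generator_nonzero:
  assumes "\<And>j. j < n \<Longrightarrow> column D j \<subseteq> {..<n}" "C \<in> same_column_sizes n D"
  shows "weyl_generator n D C \<noteq> 0"
  using assms by (auto simp: weyl_generator_def same_column_sizes_def minor_nonzero)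

text \<open>Basis-free form of the condition that every weight space of the Weyl module has
  dimension at most 1.\<close>

definition proportional_generators :: "nat \<Rightarrow> diagram \<Rightarrow> bool" where
  "proportional_generators n D \<longleftrightarrow>
     (\<forall>C \<in> same_column_sizes n D. \<forall>C' \<in> same_column_sizes n D. weight n C = weight n C' \<longrightarrow>
        (\<exists>c. weyl_generator n D C = pscale c (weyl_generator n D C')))"

text \<open>
  If \<open>A\<close>, \<open>B\<close> are two columns, the products of minors with row sets \<open>(A, B')\<close> and
  \<open>(A - k + l, B' - l + k)\<close> have the same weight. At the \<open>0\<close>-\<open>1\<close> matrix of the map \<open>\<pi>\<close> the first one
  does not vanish, but the second one does, since column \<open>k\<close> of the first minor is zero.
\<close>

lemma exchange_not_proportional:
  assumes D: "\<And>j. j < n \<Longrightarrow> column D j \<subseteq> {..<n}"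
    and j: "j < n" "j' < n" "j \<noteq> j'"
    and B': "B' \<subseteq> {..<n}" "bij_betw \<pi> B' (column D j')"
    and k: "k \<in> column D j" "k \<notin> B'" and l: "l \<in> B'" "l \<notin> column D j" "\<pi> l \<noteq> k"
    and \<pi>: "\<And>i. i \<in> column D j \<Longrightarrow> \<pi> i = i"
  shows "\<not> proportional_generators n D"
proof
  assume proportional: "proportional_generators n D"
  define A where "A = column D j"
  define A2 where "A2 = insert l (A - {k})"
  define B2 where "B2 = insert k (B' - {l})"
  \<comment> \<open>In \<open>C1\<close>, column \<open>j\<close> keeps its own rows, so its minor
    is principal, and \<open>\<pi>\<close> is the identity on these rows.\<close>
  define C1 where "C1 = (column D)(j' := B')"
  define C2 where "C2 = (column D)(j := A2, j' := B2)"
  have A: "A \<subseteq> {..<n}" "finite A" using D[OF j(1)] finite_subset by (auto simp: A_def)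
  have "finite B'" using B' finite_subset by auto
  have card_B': "card B' = card (column D j')" using B'(2) by (rule bij_betw_same_card)
  have kl: "k \<in> A" "l \<notin> A" using k l by (auto simp: A_def)
  have card_A2: "card A2 = card A"
    using A kl by (simp add: A2_def card_Suc_Diff1 del: card_Diff_singleton card_Diff_insert)
  have card_B2: "card B2 = card B'"
    using \<open>finite B'\<close> k l by (simp add: B2_def card_Suc_Diff1 del: card_Diff_singleton card_Diff_insert)
  have sub: "A2 \<subseteq> {..<n}" "B2 \<subseteq> {..<n}" using A B' k l by (auto simp: A2_def B2_def A_def)
  have C1: "C1 \<in> same_column_sizes n D"
    using D B' card_B' by (simp add: same_column_sizes_def C1_def)
  have C2: "C2 \<in> same_column_sizes n D"
    using D sub card_A2 card_B2 card_B' by (simp add: same_column_sizes_def C2_def A_def)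
  let ?R = "{..<n} - {j} - {j'}"
  have "weight n C1 = weight n C2"
  proof -
    let ?s = "\<lambda>S. \<Sum>i\<in>S. Poly_Mapping.single i (1::nat)"
    have split: "weight n C = ?s (C j) + (?s (C j') + (\<Sum>i\<in>?R. ?s (C i)))" for C
      using j by (simp add: weight_def sum.remove[of _ j] sum.remove[of _ j'])
    have "?s A + ?s B' = ?s A2 + ?s B2"
      using A \<open>finite B'\<close> kl k l
      by (simp add: A2_def B2_def sum.remove[of A k] sum.remove[of B' l] ac_simps)
    moreover have "(\<Sum>i\<in>?R. ?s (C1 i)) = (\<Sum>i\<in>?R. ?s (C2 i))"
      by (rule sum.cong) (auto simp: C1_def C2_def)
    ultimately show ?thesis
      unfolding split using j by (simp add: C1_def C2_def A_def add.assoc[symmetric])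
  qed
  with proportional C1 C2 obtain c where c: "weyl_generator n D C1 = pscale c (weyl_generator n D C2)"
    by (auto simp: proportional_generators_def)
  let ?m = "\<lambda>C j. minor n (C j) (column D j)"
  let ?g = "\<Prod>i\<in>?R. minor n (column D i) (column D i)"
  have split: "weyl_generator n D C = ?m C j * (?m C j' * (\<Prod>i\<in>?R. ?m C i))" for C
    using j by (simp add: weyl_generator_def prod.remove[of _ j] prod.remove[of _ j'])
  \<comment> \<open>Outside \<open>j\<close> and \<open>j'\<close> both generators have the same
    nonzero factor \<open>?g\<close>, which is cancelled.\<close>
  have "(\<Prod>i\<in>?R. ?m C1 i) = ?g" "(\<Prod>i\<in>?R. ?m C2 i) = ?g"
    by (auto simp: C1_def C2_def intro!: prod.cong)
  then have "?g * (?m C1 j * ?m C1 j') = ?g * (pconst c * (?m C2 j * ?m C2 j'))"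
    using c unfolding split pscale_def by (simp add: ac_simps)
  moreover have "?g \<noteq> 0" using D by (simp add: minor_nonzero)
  ultimately have eq: "?m C1 j * ?m C1 j' = pconst c * (?m C2 j * ?m C2 j')" by simp
  interpret comm_ring_hom "peval (graph_point \<pi>)" by (rule insertion_hom[OF id_hom])
  have "bij_betw \<pi> A A \<longleftrightarrow> bij_betw id A A"
    by (rule bij_betw_cong) (simp add: A_def \<pi>)
  then have "peval (graph_point \<pi>) (?m C1 j) \<noteq> 0"
    using j A by (simp add: C1_def peval_minor_graph_point_nonzero flip: A_def)
  moreover have "peval (graph_point \<pi>) (?m C1 j') \<noteq> 0"
    using j B' D by (simp add: C1_def peval_minor_graph_point_nonzero)
  \<comment> \<open>\<open>\<pi>\<close> fixes \<open>A - {k}\<close> pointwise and does not send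
    \<open>l\<close> to \<open>k\<close>, so \<open>k\<close> is missed.\<close>
  moreover have "peval (graph_point \<pi>) (?m C2 j) = 0"
    using j A k l \<pi> sub card_A2
    by (auto simp: C2_def A_def A2_def intro!: peval_minor_graph_point_zero[where d = k])
  ultimately show False using arg_cong[OF eq, of "peval (graph_point \<pi>)"] by (simp add: hom_mult)
qed

section \<open>Exchanges in Rothe diagrams\<close>

lemma column_rothe_subset: "column (rothe n w) j \<subseteq> {..<n}"
  by (auto simp: column_def rothe_def)

text \<open>An exchange needs a row \<open>l\<close> of \<open>B'\<close> outside column
  \<open>j\<close>. Row \<open>inv_into UNIV w j\<close> is never in column \<open>j\<close>, which
  provides a spare row when column \<open>j'\<close> has none to offer.\<close>

lemma rothe_not_proportional:
  assumes w: "w permutes {..<n}"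
    and box: "(i, j) \<in> rothe n w" "(i', j') \<in> rothe n w" "i \<noteq> i'" "j \<noteq> j'"
  shows "\<not> proportional_generators n (rothe n w)"
proof -
  let ?D = "rothe n w"
  note exchange = exchange_not_proportional[OF column_rothe_subset]
  have inv_notin: "inv_into UNIV w j \<notin> column ?D j" for j by (simp add: column_def rothe_def)
  have inv_less: "inv_into UNIV w j < n" if "j < n" for j
    using permutes_in_image[OF permutes_inv[OF w], of j] that by simp
  have neq: "\<not> proportional_generators n ?D"
    if j: "j < n" "j' < n" "j \<noteq> j'" and k: "k \<in> column ?D j" "k \<notin> column ?D j'"
      and x: "x \<in> column ?D j'" for j j' k x
  proof (cases "column ?D j' \<subseteq> column ?D j")
    case False
    then obtain l where "l \<in> column ?D j'" "l \<notin> column ?D j" by blast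
    then show ?thesis
      using j k by (intro exchange[where j = j and j' = j' and B' = "column ?D j'" and \<pi> = "\<lambda>i. i" and k = k and l = l])
        (auto simp: column_rothe_subset bij_betw_def)
  next
    case True
    \<comment> \<open>Column \<open>j'\<close> lies inside column \<open>j\<close>: the spare row
      \<open>q\<close> of column \<open>j\<close> replaces \<open>x\<close> in \<open>B'\<close>,
      and \<open>\<pi>\<close> sends \<open>q\<close> back to \<open>x\<close>, which differs from
      \<open>k\<close>.\<close>
    define q where "q = inv_into UNIV w j"
    have q: "q < n" "q \<notin> column ?D j" using inv_notin inv_less j by (auto simp: q_def)
    have "bij_betw ((\<lambda>i. i)(q := x)) (insert q (column ?D j' - {x})) (column ?D j')"
      using q True x by (auto simp: bij_betw_def inj_on_def)
    then show ?thesis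
      using j k x q True column_rothe_subset[of n w j']
      by (intro exchange[where j = j and j' = j' and B' = "insert q (column ?D j' - {x})" and l = q and k = k
            and \<pi> = "(\<lambda>i. i)(q := x)"]) auto
  qed
  have jn: "j < n" "j' < n" and i: "i \<in> column ?D j" "i' \<in> column ?D j'"
    using box by (auto simp: rothe_def column_def)
  consider "column ?D j = column ?D j'" | k where "k \<in> column ?D j" "k \<notin> column ?D j'"
    | k where "k \<in> column ?D j'" "k \<notin> column ?D j" by blast
  then show ?thesis
  proof cases
    case 1
    \<comment> \<open>With equal columns, a single spare row would have to be sent to the removed
      row \<open>k\<close>. So two rows are replaced by the spare rows of both columns, and
      \<open>r\<close> goes to \<open>i\<close> while \<open>k\<close> is \<open>i'\<close>.\<close>
    define r s where "r = inv_into UNIV w j" and "s = inv_into UNIV w j'"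
    have rs: "r < n" "s < n" "r \<notin> column ?D j" "s \<notin> column ?D j" "r \<noteq> s"
      using inv_notin[of j] inv_notin[of j'] inv_less jn 1 permutes_inverses[OF w] \<open>j \<noteq> j'\<close>
      by (auto simp: r_def s_def) metis
    define B' where "B' = insert r (insert s (column ?D j - {i, i'}))"
    have "bij_betw ((\<lambda>i. i)(r := i, s := i')) B' (column ?D j')"
      using rs i 1 \<open>i \<noteq> i'\<close> by (auto simp: bij_betw_def inj_on_def B'_def)
    then show ?thesis
      using jn i rs 1 \<open>i \<noteq> i'\<close> \<open>j \<noteq> j'\<close> column_rothe_subset[of n w j]
      by (intro exchange[where j = j and j' = j' and B' = B' and l = r and k = i'
            and \<pi> = "(\<lambda>i. i)(r := i, s := i')"]) (auto simp: B'_def)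
  next
    case 2
    then show ?thesis using neq[OF jn \<open>j \<noteq> j'\<close>] i by blast
  next
    case 3
    then show ?thesis using neq[OF jn(2,1) \<open>j \<noteq> j'\<close>[symmetric]] i by blast
  qed
qed

text \<open>Every minor is 1 or a single variable in column \<open>p\<close>, so a generator is its
  diagram monomial with \<open>x_i\<close> renamed to \<open>y_(i,p)\<close>; equal weights give
  equal generators.\<close>

lemma proportional_generators_one_row:
  assumes "p < n" and row: "\<And>j. j < n \<Longrightarrow> column D j \<subseteq> {p}"
  shows "proportional_generators n D"
proof -
  let ?\<phi> = "psubst (\<lambda>i. pvar (i, p))"
  interpret comm_ring_hom ?\<phi> by (rule insertion_hom[OF pconst_hom])
  have "weyl_generator n D C = ?\<phi> (diagram_monomial n C)" if C: "C \<in> same_column_sizes n D" for C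
    unfolding weyl_generator_def diagram_monomial_def hom_prod insertion_pvar[OF pconst_hom]
  proof (rule prod.cong)
    fix j assume "j \<in> {..<n}"
    then have *: "C j \<subseteq> {..<n}" "finite (C j)" "card (C j) = card (column D j)" "column D j \<subseteq> {p}"
      using C row by (auto simp: same_column_sizes_def finite_subset)
    show "minor n (C j) (column D j) = (\<Prod>i\<in>C j. pvar (i, p))"
    proof (cases "column D j = {}")
      case True
      then show ?thesis
        using * by (auto simp: minor_def dim_submatrix intro!: det_dim_zero carrier_matI)
    next
      case False
      then have "column D j = {p}" using *(4) by auto
      moreover from this obtain a where "C j = {a}" using *(3) by (auto simp: card_1_singleton_iff)
      ultimately show ?thesis
        using * \<open>p < n\<close> pick_in_set_le[of 0 "{a}"] pick_in_set_le[of 0 "{p}"]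
        by (simp add: minor_def Y_mat_def submatrix_mat det_single del: pick.simps)
    qed
  qed simp
  then have "weyl_generator n D C = pscale 1 (weyl_generator n D C')"
    if "C \<in> same_column_sizes n D" "C' \<in> same_column_sizes n D" "weight n C = weight n C'" for C C'
    using that by (simp add: diagram_monomial_eq)
  then show ?thesis unfolding proportional_generators_def by blast
qed

text \<open>For \<open>j0 < n\<close> the weight is the indicator function of \<open>C j0\<close>;
  the other columns are empty, so equal weights give equal generators.\<close>

lemma proportional_generators_one_column:
  assumes col: "\<And>j. j < n \<Longrightarrow> j \<noteq> j0 \<Longrightarrow> column D j = {}"
  shows "proportional_generators n D"
proof -
  have empty: "C j = {}" if "C \<in> same_column_sizes n D" "j < n" "j \<noteq> j0" for C j
    using that col finite_subset[of "C j" "{..<n}"] by (auto simp: same_column_sizes_def)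
  have mem: "i \<in> C j0 \<longleftrightarrow> Poly_Mapping.lookup (weight n C) i = 1"
    if "C \<in> same_column_sizes n D" "j0 < n" for C i
  proof -
    have "finite (C j0)" using that finite_subset[of "C j0" "{..<n}"] by (auto simp: same_column_sizes_def)
    have "(\<Sum>j\<in>{..<n} - {j0}. \<Sum>i\<in>C j. Poly_Mapping.single i (1::nat)) = 0"
      by (rule sum.neutral) (simp add: empty[OF that(1)])
    then have "weight n C = (\<Sum>i\<in>C j0. Poly_Mapping.single i 1)"
      using that by (simp add: weight_def sum.remove[of _ j0])
    then show ?thesis
      using \<open>finite (C j0)\<close> by (simp add: lookup_sum lookup_single when_def)
  qed
  have "weyl_generator n D C = pscale 1 (weyl_generator n D C')"
    if "C \<in> same_column_sizes n D" "C' \<in> same_column_sizes n D" "weight n C = weight n C'" for C C'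
  proof -
    have "C j = C' j" if "j < n" for j
      using that empty mem \<open>C \<in> _\<close> \<open>C' \<in> _\<close> \<open>weight n C = _\<close> by (cases "j = j0") auto
    then show ?thesis by (simp add: weyl_generator_def)
  qed
  then show ?thesis unfolding proportional_generators_def by blast
qed

text \<open>Boxes of which no two differ in both row and column all lie in one row or in one
  column.\<close>

lemma proportional_generators_rothe_iff:
  assumes w: "w permutes {..<n}"
  shows "proportional_generators n (rothe n w) \<longleftrightarrow>
    \<not> (\<exists>i j i' j'. (i, j) \<in> rothe n w \<and> (i', j') \<in> rothe n w \<and> i \<noteq> i' \<and> j \<noteq> j')"
proof
  assume no: "\<not> (\<exists>i j i' j'. (i, j) \<in> rothe n w \<and> (i', j') \<in> rothe n w \<and> i \<noteq> i' \<and> j \<noteq> j')"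
  show "proportional_generators n (rothe n w)"
  proof (cases "\<exists>p. p < n \<and> (\<forall>j<n. column (rothe n w) j \<subseteq> {p})")
    case True
    then show ?thesis by (auto intro: proportional_generators_one_row)
  next
    case no_row: False
    show ?thesis
    proof (cases "rothe n w = {}")
      case True
      then show ?thesis by (auto intro: proportional_generators_one_column simp: column_def)
    next
      case False
      then obtain p j0 where p: "(p, j0) \<in> rothe n w" by auto
      then have "p < n" by (simp add: rothe_def)
      with no_row have "\<not> (\<forall>j<n. column (rothe n w) j \<subseteq> {p})" by blast
      then obtain p' j' where p': "(p', j') \<in> rothe n w" "p' \<noteq> p"
        by (auto simp: column_def)
      \<comment> \<open>The boxes found in rows \<open>p\<close> and \<open>p'\<close> share column
        \<open>j0\<close>. A box in another column would clash with one of them, as its row cannot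
        equal both.\<close>
      have "column (rothe n w) j = {}" if "j \<noteq> j0" for j
        using that p p' no unfolding column_def by blast
      then show ?thesis by (intro proportional_generators_one_column[of _ j0])
    qed
  qed
qed (use rothe_not_proportional[OF w] in blast)

section \<open>Patterns and pairs of boxes\<close>

lemma mem_rothe_iff:
  assumes "w permutes {..<n}" "p < n" "q < n"
  shows "(p, w q) \<in> rothe n w \<longleftrightarrow> p < q \<and> w q < w p"
  using assms permutes_inverses[OF assms(1)] permutes_in_image[OF assms(1)]
  by (auto simp: rothe_def)

text \<open>The occurrence carries the inversions \<open>(a, b)\<close> and \<open>(c, d)\<close> of
  \<open>v\<close> to inversions of \<open>w\<close>, that is, to boxes; first positions give the
  rows and second positions the columns.\<close>

lemma contains_pattern_imp_boxes:
  assumes w: "w permutes {..<n}" and v: "contains_pattern n w v"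
    and ab: "a < b" "b < length v" "v ! b < v ! a" and cd: "c < d" "d < length v" "v ! d < v ! c"
    and ne: "a \<noteq> c" "b \<noteq> d"
  shows "\<exists>i j i' j'. (i, j) \<in> rothe n w \<and> (i', j') \<in> rothe n w \<and> i \<noteq> i' \<and> j \<noteq> j'"
proof -
  obtain \<iota> where mono: "strict_mono_on {..<length v} \<iota>" and sub: "\<iota> ` {..<length v} \<subseteq> {..<n}"
    and iff: "\<forall>a<length v. \<forall>b<length v. w (\<iota> a) < w (\<iota> b) \<longleftrightarrow> v ! a < v ! b"
    using v by (auto simp: contains_pattern_def)
  have less: "\<iota> a < n" if "a < length v" for a using sub that by auto
  have inj: "\<iota> a = \<iota> b \<longleftrightarrow> a = b" if "a < length v" "b < length v" for a b
    using strict_mono_on_imp_inj_on[OF mono] that by (auto simp: inj_on_def)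
  have "(\<iota> a, w (\<iota> b)) \<in> rothe n w" if "a < b" "b < length v" "v ! b < v ! a" for a b
    using that iff less strict_mono_onD[OF mono, of a b] by (subst mem_rothe_iff[OF w]) auto
  moreover have "\<iota> a \<noteq> \<iota> c" using inj ab cd ne by auto
  moreover have "w (\<iota> b) \<noteq> w (\<iota> d)" using inj ab cd ne permutes_inj[OF w] by (auto dest: injD)
  ultimately show ?thesis using ab cd by blast
qed

lemma contains_patternI:
  assumes "sorted_wrt (<) xs" "set xs \<subseteq> {..<n}" "length xs = length v"
    and "\<And>a b. a < length v \<Longrightarrow> b < length v \<Longrightarrow> w (xs ! a) < w (xs ! b) \<longleftrightarrow> v ! a < v ! b"
  shows "contains_pattern n w v"
  unfolding contains_pattern_def
  by (rule exI[of _ "(!) xs"])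
    (use assms in \<open>auto simp: strict_mono_on_def sorted_wrt_nth_less subset_iff\<close>)

text \<open>The cases follow the place of \<open>b\<close> relative to \<open>c\<close> and
  \<open>d\<close>, then the order of the values. Three decreasing values give 321; the remaining
  arrangements are the patterns of length 4.\<close>

lemma disjoint_inversions_imp_pattern:
  assumes w: "w permutes {..<n}"
    and ab: "a < b" "b < n" "w b < w a" and cd: "c < d" "d < n" "w d < w c" and ne: "b \<noteq> d" "a < c"
  shows "contains_pattern n w [3, 2, 1] \<or> contains_pattern n w [2, 1, 4, 3] \<or>
    contains_pattern n w [2, 4, 1, 3] \<or> contains_pattern n w [3, 1, 4, 2] \<or>
    contains_pattern n w [3, 4, 1, 2]"
proof -
  have inj: "w p \<noteq> w q" if "p \<noteq> q" for p q using permutes_inj[OF w] that by (auto dest: injD)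
  have three: "contains_pattern n w [3, 2, 1]" if "p < q" "q < r" "r < n" "w r < w q" "w q < w p" for p q r
    by (rule contains_patternI[of "[p, q, r]"])
      (use that in \<open>auto simp: less_Suc_eq numeral_eq_Suc\<close>)
  have p2143: "contains_pattern n w [2, 1, 4, 3]"
    if "p < q" "q < r" "r < s" "s < n" "w q < w p" "w p < w s" "w s < w r" for p q r s
    by (rule contains_patternI[of "[p, q, r, s]"])
      (use that in \<open>auto simp: less_Suc_eq numeral_eq_Suc\<close>)
  have p2413: "contains_pattern n w [2, 4, 1, 3]"
    if "p < q" "q < r" "r < s" "s < n" "w r < w p" "w p < w s" "w s < w q" for p q r s
    by (rule contains_patternI[of "[p, q, r, s]"])
      (use that in \<open>auto simp: less_Suc_eq numeral_eq_Suc\<close>)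
  have p3142: "contains_pattern n w [3, 1, 4, 2]"
    if "p < q" "q < r" "r < s" "s < n" "w q < w s" "w s < w p" "w p < w r" for p q r s
    by (rule contains_patternI[of "[p, q, r, s]"])
      (use that in \<open>auto simp: less_Suc_eq numeral_eq_Suc\<close>)
  have p3412: "contains_pattern n w [3, 4, 1, 2]"
    if "p < q" "q < r" "r < s" "s < n" "w r < w s" "w s < w p" "w p < w q" for p q r s
    by (rule contains_patternI[of "[p, q, r, s]"])
      (use that in \<open>auto simp: less_Suc_eq numeral_eq_Suc\<close>)
  consider "b = c" | "b < c" | "c < b" "b < d" | "d < b" using ne by linarith
  then show ?thesis
  proof cases
    case 1
    then show ?thesis using three[of a b d] ab cd by simp
  next
    \<comment> \<open>Separated positions \<open>a < b < c < d\<close>: without 321 the values form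
      2143 or 3142.\<close>
    case 2
    show ?thesis
    proof (cases "w a < w d")
      case True
      then show ?thesis using p2143[of a b c d] 2 ab cd by simp
    next
      case False
      then have "w d < w a" using inj[of a d] ab cd 2 by linarith
      then show ?thesis
        using three[of a b d] three[of a c d] p3142[of a b c d] inj[of b d] inj[of a c] 2 ab cd ne
        by (cases "w d < w b"; cases "w c < w a") auto
    qed
  next
    \<comment> \<open>Crossing positions \<open>a < c < b < d\<close>: without 321 the values form
      2413 or 3412, according to whether \<open>w a < w d\<close>.\<close>
    case 3
    then show ?thesis
      using three[of a c d] three[of a b d] p2413[of a c b d] p3412[of a c b d]
        inj[of b d] inj[of a c] inj[of a d] ab cd ne
      by (cases "w c < w a"; cases "w d < w b"; cases "w a < w d") auto
  next
    \<comment> \<open>Nested positions \<open>a < c < d < b\<close>: without 321 only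
      \<open>w d < w b < w a < w c\<close> remains, which is 3412.\<close>
    case 4
    then show ?thesis
      using three[of a c d] three[of c d b] p3412[of a c d b]
        inj[of b d] inj[of a c] inj[of a d] ab cd ne
      by (cases "w c < w a"; cases "w b < w d"; cases "w a < w d") auto
  qed
qed

lemma boxes_iff_contains_pattern:
  assumes w: "w permutes {..<n}"
  shows "(\<exists>i j i' j'. (i, j) \<in> rothe n w \<and> (i', j') \<in> rothe n w \<and> i \<noteq> i' \<and> j \<noteq> j') \<longleftrightarrow>
    contains_pattern n w [3, 2, 1] \<or> contains_pattern n w [2, 1, 4, 3] \<or>
    contains_pattern n w [2, 4, 1, 3] \<or> contains_pattern n w [3, 1, 4, 2] \<or>
    contains_pattern n w [3, 4, 1, 2]" (is "?L \<longleftrightarrow> ?R")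
proof
  assume ?L
  then obtain i j i' j' where box: "(i, j) \<in> rothe n w" "(i', j') \<in> rothe n w" "i \<noteq> i'" "j \<noteq> j'"
    by blast
  have *: "inv_into UNIV w j < n" "j < w i" "w (inv_into UNIV w j) = j" "i < inv_into UNIV w j" if "(i, j) \<in> rothe n w" for i j
    using that permutes_inverses[OF w] permutes_in_image[OF permutes_inv[OF w], of j]
    by (auto simp: rothe_def)
  have "inv_into UNIV w j \<noteq> inv_into UNIV w j'" using *(3) box by metis
  \<comment> \<open>The inversion with the smaller first position has to come first, hence both
    orders of the two boxes.\<close>
  then show ?R
    using disjoint_inversions_imp_pattern[OF w, of i "inv_into UNIV w j" i' "inv_into UNIV w j'"]
      disjoint_inversions_imp_pattern[OF w, of i' "inv_into UNIV w j'" i "inv_into UNIV w j"] *[OF box(1)] *[OF box(2)] box(3)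
    by (metis linorder_neqE_nat)
next
  assume ?R
  then show ?L
  \<comment> \<open>In each case the four numbers are the positions \<open>a\<close>,
    \<open>b\<close>, \<open>c\<close>, \<open>d\<close> of two inversions of the pattern with
    different first and different second positions.\<close>
  proof (elim disjE)
    assume "contains_pattern n w [3, 2, 1]"
    then show ?L by (rule contains_pattern_imp_boxes[OF w, of _ 0 1 1 2]) simp_all
  next
    assume "contains_pattern n w [2, 1, 4, 3]"
    then show ?L by (rule contains_pattern_imp_boxes[OF w, of _ 0 1 2 3]) simp_all
  next
    assume "contains_pattern n w [2, 4, 1, 3]"
    then show ?L by (rule contains_pattern_imp_boxes[OF w, of _ 0 2 1 3]) simp_all
  next
    assume "contains_pattern n w [3, 1, 4, 2]"
    then show ?L by (rule contains_pattern_imp_boxes[OF w, of _ 0 1 2 3]) simp_all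
  next
    assume "contains_pattern n w [3, 4, 1, 2]"
    then show ?L by (rule contains_pattern_imp_boxes[OF w, of _ 0 2 1 3]) simp_all
  qed
qed

section \<open>The lower bound\<close>

context
  fixes n :: nat and D :: diagram and K
  assumes D: "\<And>j. j < n \<Longrightarrow> column D j \<subseteq> {..<n}" and K: "weyl_basis n D K"
begin

text \<open>If a weight were absent from the basis, its generators would lie in the span of the
  empty set, but they are nonzero.\<close>

lemma weyl_basis_weight_exists:
  assumes "C \<in> same_column_sizes n D"
  obtains C' where "C' \<in> K" "weight n C' = weight n C"
proof -
  have "{C' \<in> K. weight n C' = weight n C} \<noteq> {}"
  proof
    assume "{C' \<in> K. weight n C' = weight n C} = {}"
    with weyl_generator_in_weight_span[OF D K assms] have "weyl_generator n D C = 0"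
      by (simp add: mpoly.span_empty)
    then show False using weyl_generator_nonzero[OF D assms] by blast
  qed
  then show ?thesis using that by blast
qed

text \<open>Proportional basis vectors of one weight contradict independence; conversely, a unique
  basis vector of a weight has all generators of this weight as multiples.\<close>

lemma inj_on_weight_iff_proportional: "inj_on (weight n) K \<longleftrightarrow> proportional_generators n D"
proof -
  let ?f = "weyl_generator n D"
  have K': "K \<subseteq> same_column_sizes n D" "inj_on ?f K" "mpoly.independent (?f ` K)"
    using K by (auto simp: weyl_basis_def)
  show ?thesis
  proof
    assume proportional: "proportional_generators n D"
    show "inj_on (weight n) K"
    proof (rule inj_onI, rule ccontr)
      fix C C' assume C: "C \<in> K" "C' \<in> K" "weight n C = weight n C'" "C \<noteq> C'"
      then obtain c where "?f C = pscale c (?f C')"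
        using proportional K' unfolding proportional_generators_def by blast
      then have "?f C \<in> mpoly.span {?f C'}" by (metis mpoly.span_base mpoly.span_scale singletonI)
      moreover have "?f C' \<in> ?f ` K - {?f C}" using C K' by (auto simp: inj_on_def)
      ultimately have "?f C \<in> mpoly.span (?f ` K - {?f C})"
        by (meson empty_subsetI insert_subset mpoly.span_mono subset_iff)
      then show False using K'(3) C by (auto simp: mpoly.dependent_def)
    qed
  next
    assume inj: "inj_on (weight n) K"
    show "proportional_generators n D"
      unfolding proportional_generators_def
    proof (intro ballI impI)
      fix C C' assume C: "C \<in> same_column_sizes n D" "C' \<in> same_column_sizes n D"
        and eq: "weight n C = weight n C'"
      obtain B where B: "B \<in> K" "weight n B = weight n C'"
        using weyl_basis_weight_exists[OF C(2)] .
      then have "{B' \<in> K. weight n B' = weight n C'} = {B}"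
        using inj by (auto simp: inj_on_def)
      with weyl_generator_in_weight_span[OF D K C(1)] weyl_generator_in_weight_span[OF D K C(2)] eq
      obtain a a' where a: "?f C = pscale a (?f B)" "?f C' = pscale a' (?f B)"
        by (auto simp: mpoly.span_singleton)
      have "a' \<noteq> 0" using a weyl_generator_nonzero[OF D C(2)] by auto
      then have "?f C = pscale (a / a') (?f C')" using a by simp
      then show "\<exists>c. ?f C = pscale c (?f C')" ..
    qed
  qed
qed

text \<open>The coefficients are the weight multiplicities of the Weyl module.\<close>

lemma lookup_sum_diagram_monomial:
  "Poly_Mapping.lookup (\<Sum>C\<in>K. diagram_monomial n C) m = of_nat (card {C \<in> K. weight n C = m})"
proof -
  have "finite K" using K by (simp add: weyl_basis_def)
  have "Poly_Mapping.lookup (\<Sum>C\<in>K. diagram_monomial n C) m = (\<Sum>C\<in>K. if weight n C = m then 1 else 0)"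
    by (simp add: lookup_sum diagram_monomial_eq lookup_single when_def)
  also have "\<dots> = of_nat (card {C \<in> K. weight n C = m})"
    using \<open>finite K\<close> by (simp add: sum.If_cases Int_def)
  finally show ?thesis .
qed

lemma lookup_zero_one_iff:
  "(\<forall>m. Poly_Mapping.lookup (\<Sum>C\<in>K. diagram_monomial n C) m \<in> {0, 1}) \<longleftrightarrow> inj_on (weight n) K"
proof -
  have fin: "finite {C \<in> K. weight n C = m}" for m using K by (simp add: weyl_basis_def)
  have "(\<forall>m. Poly_Mapping.lookup (\<Sum>C\<in>K. diagram_monomial n C) m \<in> {0, 1}) \<longleftrightarrow>
      (\<forall>m. card {C \<in> K. weight n C = m} \<le> 1)"
    unfolding lookup_sum_diagram_monomial by (auto simp: le_Suc_eq)
  also have "\<dots> \<longleftrightarrow> inj_on (weight n) K"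
    using fin by (auto simp: card_le_Suc0_iff_eq inj_on_def)
  finally show ?thesis .
qed

text \<open>By \<open>weyl_basis_weight_exists\<close> both sums involve the same monomials, so they
  agree exactly when none is repeated on the left.\<close>

lemma sum_monomials_eq_iff:
  "(\<Sum>C\<in>K. diagram_monomial n C) = (\<Sum>m \<in> diagram_monomial n ` same_column_sizes n D. m) \<longleftrightarrow>
    inj_on (weight n) K" (is "?P = ?L \<longleftrightarrow> _")
proof -
  let ?M = "diagram_monomial n ` same_column_sizes n D"
  have inj: "inj_on (diagram_monomial n) K \<longleftrightarrow> inj_on (weight n) K"
    by (simp add: inj_on_def diagram_monomial_eq_iff)
  have K': "K \<subseteq> same_column_sizes n D" using K by (simp add: weyl_basis_def)
  have M: "?M = diagram_monomial n ` K"
  proof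
    show "?M \<subseteq> diagram_monomial n ` K"
    proof
      fix p assume "p \<in> ?M"
      then obtain C where C: "C \<in> same_column_sizes n D" "p = diagram_monomial n C" by blast
      obtain C' where "C' \<in> K" "weight n C' = weight n C"
        using weyl_basis_weight_exists[OF C(1)] .
      then show "p \<in> diagram_monomial n ` K"
        using C(2) diagram_monomial_eq_iff by (metis imageI)
    qed
  qed (rule image_mono[OF K'])
  show ?thesis
  proof
    assume "inj_on (weight n) K"
    then show "?P = ?L" unfolding M using inj by (simp add: sum.reindex)
  next
    assume eq: "?P = ?L"
    have "finite ?M"
      by (rule finite_image_same_column_sizes) (simp add: diagram_monomial_def)
    have "Poly_Mapping.lookup ?L m \<in> {0, 1}" for m
    proof -
      \<comment> \<open>Only one member of \<open>?M\<close> can contribute at \<open>m\<close>, so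
        a sum over distinct monomials has coefficients 0 and 1.\<close>
      have "Poly_Mapping.lookup ?L m = (\<Sum>p\<in>?M. if p = Poly_Mapping.single m 1 then 1 else 0)"
        unfolding lookup_sum
      proof (rule sum.cong)
        fix p assume "p \<in> ?M"
        then obtain e where p: "p = Poly_Mapping.single e 1" by (auto simp: diagram_monomial_eq)
        have "Poly_Mapping.keys p = {e}" by (simp add: p)
        then have "p = Poly_Mapping.single m 1 \<Longrightarrow> e = m" by simp
        then show "Poly_Mapping.lookup p m = (if p = Poly_Mapping.single m 1 then 1 else 0)"
          by (auto simp: p lookup_single when_def)
      qed simp
      then show ?thesis using \<open>finite ?M\<close> by (simp add: sum.delta)
    qed
    then show "inj_on (weight n) K" using lookup_zero_one_iff eq by simp
  qed
qed

end

text \<open>On the torus the Stanley function is the evaluation of \<open>?P\<close>, and a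
  polynomial is determined by its values there; both conditions thus concern the coefficients of
  \<open>?P\<close>.\<close>

lemma attains_lower_bound_iff: "attains_lower_bound n w \<longleftrightarrow> proportional_generators n (rothe n w)"
  and zero_one_coefficients_iff: "zero_one_coefficients n w \<longleftrightarrow> proportional_generators n (rothe n w)"
proof -
  let ?D = "rothe n w"
  obtain K where K: "weyl_basis n ?D K" using weyl_basis_exists by blast
  let ?P = "\<Sum>C\<in>K. diagram_monomial n C"
  have stanley: "stanley n w x = peval x ?P" if "x \<in> torus n" for x
    using that by (simp add: stanley_def schur_char_eq_peval[OF column_rothe_subset K])
  have "attains_lower_bound n w \<longleftrightarrow> ?P = (\<Sum>m \<in> diagram_monomial n ` same_column_sizes n ?D. m)"
    using stanley by (auto simp: attains_lower_bound_def intro: eq_on_torus_imp_eq[of n])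
  then show "attains_lower_bound n w \<longleftrightarrow> proportional_generators n ?D"
    using sum_monomials_eq_iff[OF column_rothe_subset K]
      inj_on_weight_iff_proportional[OF column_rothe_subset K] by simp
  \<comment> \<open>The expansion is unique, so the existential quantifier in
    \<open>zero_one_coefficients\<close> reduces to \<open>?P\<close>.\<close>
  have "is_monomial_expansion n (stanley n w) p \<longleftrightarrow> p = ?P" for p
  proof
    assume "is_monomial_expansion n (stanley n w) p"
    then show "p = ?P"
      using stanley by (intro eq_on_torus_imp_eq[of n]) (simp add: is_monomial_expansion_def)
  next
    assume p: "p = ?P"
    have "Poly_Mapping.keys m \<subseteq> {..<n}" if "m \<in> Poly_Mapping.keys ?P" for m
    proof -
      from that have "{C \<in> K. weight n C = m} \<noteq> {}"
        by (metis (no_types, lifting) K card.empty column_rothe_subset in_keys_iff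
            lookup_sum_diagram_monomial of_nat_0)
      then obtain C where "C \<in> K" "weight n C = m" by blast
      then have "C \<in> same_column_sizes n ?D" "weight n C = m"
        using K by (auto simp: weyl_basis_def)
      then show ?thesis
        using keys_weight_subset by blast
    qed
    then show "is_monomial_expansion n (stanley n w) p"
      using stanley p by (simp add: is_monomial_expansion_def)
  qed
  then show "zero_one_coefficients n w \<longleftrightarrow> proportional_generators n ?D"
    using lookup_zero_one_iff[OF column_rothe_subset K]
      inj_on_weight_iff_proportional[OF column_rothe_subset K]
    by (simp add: zero_one_coefficients_def)
qed

theorem corollary3p3:
  fixes n :: nat and w :: "nat \<Rightarrow> nat"
  assumes "w permutes {..<n}"
  shows "(attains_lower_bound n w \<longleftrightarrow> zero_one_coefficients n w) \<and>
    (attains_lower_bound n w \<longleftrightarrow>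
      avoids_pattern n w [3, 2, 1] \<and>
      avoids_pattern n w [2, 1, 4, 3] \<and>
      avoids_pattern n w [2, 4, 1, 3] \<and>
      avoids_pattern n w [3, 1, 4, 2] \<and>
      avoids_pattern n w [3, 4, 1, 2])"
  using proportional_generators_rothe_iff[OF assms] boxes_iff_contains_pattern[OF assms]
  by (simp only: attains_lower_bound_iff zero_one_coefficients_iff de_Morgan_disj simp_thms)

end
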